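(* Let $U$ be a linear operator on $\mathbb K[x]$, let $Q$ be a delta operator with umbral operator $\phi$. Suppose that, as formal power series in $x,t$, \[ \frac{G_{U\phi}(x,t)}{G_\phi(x,t)}=\sum_{k=0}^\infty f_k(x)g_k(t) \] for some formal power series $(f_k)_{k\in\mathbb N}$, $(g_k)_{k\in\mathbb N}$. Then $U=\sum_{k=0}^\infty f_k(\hat x)\,g_k(Q)$.
   Context: $\mathbb K$ is a field of characteristic zero; $\hat x$ is multiplication by $x$, $D=d/dx$; shift-invariant operators (commuting with all shifts $f(x)\mapsto f(x+a)$) are formal power series in $D$. A delta operator is a shift-invariant $Q$ with $Qx$ a nonzero constant; its umbral operator $\phi$ is given by $\phi x^n=\phi_n(x)$ where $(\phi_n)$ is the unique polynomial sequence with $\deg\phi_n=n$, $\phi_0=1$, $\phi_n(0)=0$ ($n\ge1$), $Q\phi_n=n\phi_{n-1}$. For a linear operator $\psi$ on $\mathbb K[x]$, its exponential generating function is $G_\psi(x,t)=\sum_{n\ge0}(\psi x^n)\frac{t^n}{n!}$. (One has $G_\phi(x,t)=e^{x\tilde Q^{-1}(t)}$ with $\tilde Q$ the power series such that $Q=\tilde Q(D)$, so it is invertible.) *)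

theory Defs
  imports "HOL-Computational_Algebra.Computational_Algebra"
begin

abbreviation linear_operator :: "('a::field_char_0 poly \<Rightarrow> 'a poly) \<Rightarrow> bool" where
  "linear_operator \<equiv> Vector_Spaces.linear smult smult"

definition shift_invariant :: "('a::field_char_0 poly \<Rightarrow> 'a poly) \<Rightarrow> bool" where
  "shift_invariant T \<longleftrightarrow>
     linear_operator T \<and> (\<forall>a p. T (pcompose p [:a, 1:]) = pcompose (T p) [:a, 1:])"

definition delta_operator :: "('a::field_char_0 poly \<Rightarrow> 'a poly) \<Rightarrow> bool" where
  "delta_operator Q \<longleftrightarrow> shift_invariant Q \<and> (\<exists>c. c \<noteq> 0 \<and> Q [:0, 1:] = [:c:])"

definition basic_sequence ::
  "('a::field_char_0 poly \<Rightarrow> 'a poly) \<Rightarrow> (nat \<Rightarrow> 'a poly) \<Rightarrow> bool" where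
  "basic_sequence Q s \<longleftrightarrow>
     (\<forall>n. degree (s n) = n) \<and> s 0 = 1 \<and> (\<forall>n\<ge>1. poly (s n) 0 = 0) \<and>
     (\<forall>n\<ge>1. Q (s n) = smult (of_nat n) (s (n - 1)))"

definition umbral_operator ::
  "('a::field_char_0 poly \<Rightarrow> 'a poly) \<Rightarrow> ('a poly \<Rightarrow> 'a poly) \<Rightarrow> bool" where
  "umbral_operator Q \<phi> \<longleftrightarrow> linear_operator \<phi> \<and> basic_sequence Q (\<lambda>n. \<phi> (monom 1 n))"

text \<open>
  Formal power series in \<open>x, t\<close> are elements of \<open>'a fps fps\<close>, the outer variable being \<open>t\<close> and the
  inner one \<open>x\<close>; the coefficient of \<open>x\<^sup>m t\<^sup>n\<close> in \<open>S\<close> is \<open>fps_nth (fps_nth S n) m\<close>.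
\<close>

definition egf :: "('a::field_char_0 poly \<Rightarrow> 'a poly) \<Rightarrow> 'a fps fps" where
  "egf \<psi> = Abs_fps (\<lambda>n. fps_of_poly (smult (1 / fact n) (\<psi> (monom 1 n))))"

text \<open>The series \<open>f(x) g(t)\<close>.\<close>

definition fps_sep :: "'a::field_char_0 fps \<Rightarrow> 'a fps \<Rightarrow> 'a fps fps" where
  "fps_sep f g = Abs_fps (\<lambda>n. f * fps_const (fps_nth g n))"

text \<open>
  Convergence of a series in \<open>K[[x,t]]\<close>: each coefficient of the partial sums is eventually constant,
  i.e. convergence in the \<open>(x,t)\<close>-adic topology. The library topology on \<open>'a fps fps\<close> is only
  \<open>t\<close>-adic, hence finer: there a series such as \<open>\<Sum>k. x\<^sup>k\<close> does not converge.
\<close>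

definition fps2_sums :: "(nat \<Rightarrow> 'a::field_char_0 fps fps) \<Rightarrow> 'a fps fps \<Rightarrow> bool" where
  "fps2_sums F S \<longleftrightarrow>
     (\<forall>m n. \<forall>\<^sub>F N in sequentially.
        (\<Sum>k<N. fps_nth (fps_nth (F k) n) m) = fps_nth (fps_nth S n) m)"

text \<open>
  The operator \<open>g(Q) = \<Sum>j. g\<^sub>j Q\<^sup>j\<close>. Only finitely many \<open>Q\<^sup>j p\<close> are nonzero when \<open>Q\<close> is a delta
  operator, see \<open>finite_funpow_nonzero\<close> below.
\<close>

definition fps_operator ::
  "'a::field_char_0 fps \<Rightarrow> ('a poly \<Rightarrow> 'a poly) \<Rightarrow> 'a poly \<Rightarrow> 'a poly" where
  "fps_operator g Q p = (\<Sum>j | (Q ^^ j) p \<noteq> 0. smult (fps_nth g j) ((Q ^^ j) p))"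

lemma vector_space_smult: "vector_space (smult :: 'a::field_char_0 \<Rightarrow> _)"
  by unfold_locales (simp_all add: smult_add_right smult_add_left)

lemma egf_umbral_mult_inverse:
  fixes Q :: "'a::field_char_0 poly \<Rightarrow> 'a poly"
  assumes "umbral_operator Q \<phi>"
  shows "egf \<phi> * inverse (egf \<phi>) = 1"
proof -
  have *: "egf \<phi> $ 0 = 1"
    using assms by (simp add: egf_def umbral_operator_def basic_sequence_def)
  have "inverse (1 :: 'a fps) = 1" by (rule fps_inverse_one)
  then show ?thesis
    unfolding fps_inverse_def[of "egf \<phi>"]
    by (intro fps_right_inverse) (simp only: * mult_1_left)
qed

lemma egf_umbral_divide:
  assumes "umbral_operator Q \<phi>"
  shows "S / egf \<phi> = S * inverse (egf \<phi>)"
proof -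
  have "egf \<phi> $ 0 = 1"
    using assms by (simp add: egf_def umbral_operator_def basic_sequence_def)
  then show ?thesis by (simp add: fps_divide_unit)
qed

lemma funpow_eq_0:
  assumes "delta_operator Q" "basic_sequence Q s" "degree p < n"
  shows "(Q ^^ n) p = 0"
proof -
  interpret Q: Vector_Spaces.linear smult smult Q
    using assms(1) by (simp add: delta_operator_def shift_invariant_def)
  have deg: "degree (s n) = n" and s0: "s 0 = 1"
    and step: "Q (s (Suc n)) = smult (of_nat (Suc n)) (s n)" for n
    using assms(2) by (auto simp: basic_sequence_def)
  obtain c where c: "Q [:0, 1:] = [:c:]" using assms(1) by (auto simp: delta_operator_def)
  have "Q (pcompose [:0, 1:] [:1, 1:]) = pcompose (Q [:0, 1:]) [:1, 1:]"
    using assms(1) by (simp only: delta_operator_def shift_invariant_def)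
  then have "Q ([:0, 1:] + 1) = [:c:]" by (simp add: c pcompose_pCons one_pCons)
  then have Q1: "Q 1 = 0" using Q.add[of "[:0, 1:]" 1] c by simp
  have pow: "(Q ^^ n) (p + q) = (Q ^^ n) p + (Q ^^ n) q"
    "(Q ^^ n) (smult a p) = smult a ((Q ^^ n) p)" for n p q a
    by (induction n) (simp_all add: Q.add Q.scale)
  have basic0: "(Q ^^ Suc n) (s n) = 0" for n
  proof (induction n)
    case (Suc n)
    have "(Q ^^ Suc (Suc n)) (s (Suc n)) = (Q ^^ Suc n) (Q (s (Suc n)))"
      by (simp only: funpow_Suc_right o_apply)
    then show ?case using Suc by (simp only: step pow smult_0_right)
  qed (simp add: s0 Q1)
  show ?thesis using assms(3)
  proof (induction n arbitrary: p)
    case (Suc n)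
    define a where "a = coeff p n / lead_coeff (s n)"
    define q where "q = p - smult a (s n)"
    have "s n \<noteq> 0" using deg[of n] s0 by (cases n) auto
    then have "coeff q n = 0" using deg[of n] leading_coeff_0_iff[of "s n"]
      by (simp add: q_def a_def)
    moreover have "degree q \<le> n"
      using Suc.prems deg[of n] by (auto simp: q_def intro!: degree_diff_le)
    ultimately have "q = 0 \<or> degree q < n"
      using leading_coeff_0_iff[of q] by (cases "degree q = n") auto
    then have "(Q ^^ Suc n) q = 0"
    proof
      assume "q = 0"
      then show ?thesis using pow(2)[of "Suc n" 0 q] by simp
    qed (simp add: Suc.IH Q.zero)
    moreover have "p = q + smult a (s n)" by (simp add: q_def)
    ultimately show ?case by (simp only: pow basic0 smult_0_right add_0_left)
  qed simp
qed

lemma finite_funpow_nonzero: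
  assumes "delta_operator Q" "basic_sequence Q s"
  shows "finite {j. (Q ^^ j) p \<noteq> 0}"
  by (rule finite_subset[of _ "{..degree p}"])
    (use funpow_eq_0[OF assms] in \<open>auto simp: not_le[symmetric]\<close>)

end

theory Submission
  imports Defs
begin

text \<open>
  Comparing coefficients of \<open>t\<^sup>n\<close> in \<open>(\<Sum>k. f\<^sub>k(x) g\<^sub>k(t)) \<cdot> G\<^sub>\<phi>(x,t) = G\<^sub>U\<^sub>\<phi>(x,t)\<close> gives the claim on
  the basic sequence, because \<open>Q\<^sup>j \<phi>\<^sub>n / n! = \<phi>\<^sub>n\<^sub>-\<^sub>j / (n-j)!\<close> makes \<open>f\<^sub>k(x) g\<^sub>k(Q) \<phi>\<^sub>n / n!\<close> the coefficient of
  \<open>t\<^sup>n\<close> in \<open>f\<^sub>k(x) g\<^sub>k(t) G\<^sub>\<phi>(x,t)\<close>. The basic sequence spans the polynomials, so linearity does the rest.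
\<close>

text \<open>The topology on \<open>'a fps\<close> is the adic one, so convergence may be checked one
  coefficient at a time.\<close>

lemma fps_sums_if_eventually_nth_eq:
  fixes a :: "nat \<Rightarrow> 'a::comm_ring_1 fps"
  assumes "\<And>m. \<forall>\<^sub>F N in sequentially. (\<Sum>k<N. a k $ m) = S $ m"
  shows "a sums S"
  unfolding sums_def
  by (rule tendsto_fpsI) (use assms in \<open>simp add: fps_sum_nth\<close>)

text \<open>Each coefficient of a product involves only finitely many coefficients of the left
  factor, so some common \<open>N\<close> settles all of them.\<close>

lemma fps2_sums_mult_right:
  assumes "fps2_sums F S"
  shows "fps2_sums (\<lambda>k. F k * G) (S * G)"
  unfolding fps2_sums_def
proof (intro allI)
  fix m n
  have "\<forall>\<^sub>F N in sequentially. \<forall>i\<in>{..n}. \<forall>j\<in>{..m}.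
      (\<Sum>k<N. F k $ i $ j) = S $ i $ j"
    using assms by (simp add: fps2_sums_def eventually_ball_finite_distrib)
  then show "\<forall>\<^sub>F N in sequentially. (\<Sum>k<N. (F k * G) $ n $ m) = (S * G) $ n $ m"
  proof eventually_elim
    case (elim N)
    have "(\<Sum>k<N. (F k * G) $ n $ m) = ((\<Sum>k<N. F k) * G) $ n $ m"
      by (simp add: sum_distrib_right fps_sum_nth)
    also have "\<dots> = (\<Sum>i=0..n. \<Sum>j=0..m. (\<Sum>k<N. F k $ i $ j) * G $ (n - i) $ (m - j))"
      by (simp add: fps_mult_nth fps_sum_nth)
    also have "\<dots> = (\<Sum>i=0..n. \<Sum>j=0..m. S $ i $ j * G $ (n - i) $ (m - j))"
      using elim by (intro sum.cong refl) simp
    also have "\<dots> = (S * G) $ n $ m"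
      by (simp add: fps_mult_nth fps_sum_nth)
    finally show ?case .
  qed
qed

lemma funpow_basic_sequence:
  assumes "linear_operator Q" "basic_sequence Q s" "j \<le> n"
  shows "(Q ^^ j) (s n) = smult (fact n / fact (n - j)) (s (n - j))"
  using assms(3)
proof (induction j)
  case (Suc j)
  interpret Q: Vector_Spaces.linear smult smult Q by (rule assms(1))
  from Suc.prems obtain l where l: "n - j = Suc l" "n - Suc j = l"
    by (metis Suc_diff_Suc Suc_le_lessD)
  have "Q (s (Suc l)) = smult (of_nat (Suc l)) (s l)"
    using assms(2) by (auto simp: basic_sequence_def)
  then show ?case using Suc
    by (simp add: l Q.scale field_simps del: of_nat_Suc)
qed simp

text \<open>The index set in \<open>fps_operator\<close> varies with \<open>p\<close>; a range fixed
  by a degree bound lets different polynomials share one sum.\<close>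

lemma fps_operator_eq_sum_atMost:
  assumes "delta_operator Q" "basic_sequence Q s" "degree p \<le> n"
  shows "fps_operator g Q p = (\<Sum>j\<le>n. smult (fps_nth g j) ((Q ^^ j) p))"
  unfolding fps_operator_def
proof (rule sum.mono_neutral_left)
  show "{j. (Q ^^ j) p \<noteq> 0} \<subseteq> {..n}"
    using funpow_eq_0[OF assms(1,2), of p] assms(3) by (force simp flip: not_le)
qed auto

lemma fps_operator_add_smult:
  assumes "delta_operator Q" "basic_sequence Q s"
  shows "fps_operator g Q (p + smult a q) = fps_operator g Q p + smult a (fps_operator g Q q)"
proof -
  interpret Q: Vector_Spaces.linear smult smult Q
    using assms(1) by (simp add: delta_operator_def shift_invariant_def)
  define n where "n = max (degree p) (degree q)"
  have deg: "degree p \<le> n" "degree q \<le> n" "degree (p + smult a q) \<le> n"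
    using degree_smult_le[of a q] by (auto simp: n_def intro!: degree_add_le)
  have pow: "(Q ^^ j) (p + smult a q) = (Q ^^ j) p + smult a ((Q ^^ j) q)" for j
    by (induction j) (simp_all add: Q.add Q.scale)
  have "fps_operator g Q q = (\<Sum>j\<le>n. smult (fps_nth g j) ((Q ^^ j) q))"
    by (rule fps_operator_eq_sum_atMost[OF assms deg(2)])
  then have "smult a (fps_operator g Q q) = (\<Sum>j\<le>n. smult (fps_nth g j) (smult a ((Q ^^ j) q)))"
    by (simp add: Q.vs1.scale_sum_right mult.commute)
  then show ?thesis
    by (simp add: fps_operator_eq_sum_atMost[OF assms deg(1)]
        fps_operator_eq_sum_atMost[OF assms deg(3)] pow smult_add_right sum.distrib)
qed

text \<open>Since \<open>s n\<close> has degree \<open>n\<close>, subtracting multiples of the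
  \<open>s n\<close> removes the top coefficients one after another until 0 is left.\<close>

lemma basic_sequence_induct [consumes 1, case_names zero add]:
  fixes p :: "'a::field_char_0 poly"
  assumes "basic_sequence Q s" "P 0"
    and "\<And>q a n. P q \<Longrightarrow> P (q + smult a (s n))"
  shows "P p"
proof -
  have deg: "degree (s n) = n" and s0: "s 0 = 1" for n
    using assms(1) by (auto simp: basic_sequence_def)
  \<comment> \<open>Bounding the support instead of the degree makes the base case exactly
    \<open>p = 0\<close>.\<close>
  have "P p" if "\<forall>i\<ge>n. coeff p i = 0" for n
    using that
  proof (induction n arbitrary: p)
    case 0
    then have "p = 0" by (simp add: poly_eq_iff)
    with assms(2) show ?case by simp
  next
    case (Suc n)
    define a where "a = coeff p n / lead_coeff (s n)"
    have "s n \<noteq> 0" using deg[of n] s0 by (cases n) auto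
    then have "coeff (s n) n \<noteq> 0" using deg[of n] leading_coeff_0_iff[of "s n"] by simp
    then have "coeff (p - smult a (s n)) i = 0" if "i \<ge> n" for i
      using that Suc.prems deg[of n] coeff_eq_0[of "s n" i] by (cases "i = n") (auto simp: a_def)
    then have "P ((p - smult a (s n)) + smult a (s n))" by (intro assms(3) Suc.IH) simp
    then show ?case by simp
  qed
  from this[of "Suc (degree p)"] show ?thesis by (simp add: coeff_eq_0)
qed

lemma fps_sep_mult_egf_nth:
  assumes "delta_operator Q" "umbral_operator Q \<phi>"
  shows "(fps_sep f g * egf \<phi>) $ n =
    fps_const (1 / fact n) * (f * fps_of_poly (fps_operator g Q (\<phi> (monom 1 n))))"
proof -
  have lin: "linear_operator Q" and bs: "basic_sequence Q (\<lambda>n. \<phi> (monom 1 n))"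
    using assms by (auto simp: delta_operator_def shift_invariant_def umbral_operator_def)
  have deg: "degree (\<phi> (monom 1 n)) \<le> n" using bs by (simp add: basic_sequence_def)
  have *: "fps_operator g Q (\<phi> (monom 1 n)) =
      (\<Sum>j\<le>n. smult (g $ j * (fact n / fact (n - j))) (\<phi> (monom 1 (n - j))))"
    unfolding fps_operator_eq_sum_atMost[OF assms(1) bs deg]
    by (intro sum.cong refl) (simp add: funpow_basic_sequence[OF lin bs])
  have summand: "fps_sep f g $ j * egf \<phi> $ (n - j) = fps_const (1 / fact n) *
      (f * fps_of_poly (smult (g $ j * (fact n / fact (n - j))) (\<phi> (monom 1 (n - j)))))" for j
  proof -
    \<comment> \<open>The weight \<open>1 / fact (n - j)\<close> from \<open>egf\<close> is
      \<open>1 / fact n\<close> times the factor that \<open>Q ^^ j\<close> produces on the basic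
      sequence.\<close>
    have "fps_const (g $ j) * fps_const (1 / fact (n - j)) =
        fps_const (1 / fact n) * fps_const (g $ j * (fact n / fact (n - j)))"
      by simp
    then have "f * (fps_const (g $ j) * fps_const (1 / fact (n - j))) *
          fps_of_poly (\<phi> (monom 1 (n - j))) =
        f * (fps_const (1 / fact n) * fps_const (g $ j * (fact n / fact (n - j)))) *
          fps_of_poly (\<phi> (monom 1 (n - j)))"
      by (simp only:)
    then show ?thesis
      unfolding fps_sep_def egf_def fps_nth_Abs_fps fps_of_poly_smult by (simp only: mult_ac)
  qed
  show ?thesis
    unfolding * fps_of_poly_sum sum_distrib_left fps_mult_nth atMost_atLeast0
    by (intro sum.cong refl summand)
qed

theorem mainTheorem6:
  fixes U Q \<phi> :: "'a::field_char_0 poly \<Rightarrow> 'a poly"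
    and f g :: "nat \<Rightarrow> 'a fps"
  assumes "linear_operator U"
    and "delta_operator Q"
    and "umbral_operator Q \<phi>"
    and "fps2_sums (\<lambda>k. fps_sep (f k) (g k)) (egf (U \<circ> \<phi>) / egf \<phi>)"
  shows "\<forall>p. (\<lambda>k. f k * fps_of_poly (fps_operator (g k) Q p)) sums fps_of_poly (U p)"
proof
  fix p
  interpret U: Vector_Spaces.linear smult smult U by (rule assms(1))
  define T where "T k p = f k * fps_of_poly (fps_operator (g k) Q p)" for k p
  have bs: "basic_sequence Q (\<lambda>n. \<phi> (monom 1 n))"
    using assms(3) by (simp add: umbral_operator_def)
  have T_add: "T k (p + smult a q) = T k p + fps_const a * T k q" for k p a q
    by (simp add: T_def fps_operator_add_smult[OF assms(2) bs] fps_of_poly_add fps_of_poly_smult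
        algebra_simps)
  have T_zero: "T k 0 = 0" for k
    \<comment> \<open>This instance reads \<open>T k 0 = T k 0 - T k 0\<close>.\<close>
    using T_add[of k 0 "-1" 0] by simp
  \<comment> \<open>The quotient can be cleared because \<open>egf \<phi>\<close> has constant term
    1 in \<open>t\<close>, hence is a unit.\<close>
  have "egf (U \<circ> \<phi>) / egf \<phi> * egf \<phi> = egf (U \<circ> \<phi>)"
    using egf_umbral_mult_inverse[OF assms(3)]
    by (simp add: egf_umbral_divide[OF assms(3)] mult.assoc mult.commute[of "inverse _"])
  with fps2_sums_mult_right[OF assms(4), of "egf \<phi>"]
  have "fps2_sums (\<lambda>k. fps_sep (f k) (g k) * egf \<phi>) (egf (U \<circ> \<phi>))" by simp
  \<comment> \<open>Both sides of the \<open>t\<close>-coefficient carry the factor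
    \<open>1 / fact n\<close>, which cancels.\<close>
  then have basic: "\<forall>\<^sub>F N in sequentially.
      (\<Sum>k<N. T k (\<phi> (monom 1 n)) $ m) = fps_of_poly (U (\<phi> (monom 1 n))) $ m" for m n
    by (simp add: fps2_sums_def fps_sep_mult_egf_nth[OF assms(2,3)] T_def[symmetric]
        egf_def[of "U \<circ> \<phi>"] fps_of_poly_smult flip: sum_divide_distrib)
  \<comment> \<open>The threshold for \<open>N\<close> depends on \<open>p\<close>: each induction
    step takes an \<open>N\<close> past the thresholds of \<open>q\<close> and of the new basis
    element, where the finite sums are linear.\<close>
  have "\<forall>\<^sub>F N in sequentially. (\<Sum>k<N. T k p $ m) = fps_of_poly (U p) $ m" for m
    using bs
  proof (induction p rule: basic_sequence_induct)
    case zero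
    show ?case by (simp add: T_zero U.zero)
  next
    case (add q a n)
    from add basic[of n m] show ?case
      by eventually_elim
        (simp add: T_add U.add U.scale fps_of_poly_add fps_of_poly_smult sum.distrib
          flip: sum_distrib_left)
  qed
  then show "(\<lambda>k. f k * fps_of_poly (fps_operator (g k) Q p)) sums fps_of_poly (U p)"
    unfolding T_def by (rule fps_sums_if_eventually_nth_eq)
qed

end
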